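(* Let $\varepsilon > 0$ be constant and suppose $\omega = \omega(n) = o(\log\log n)$ tends to infinity arbitrarily slowly with $n$. Suppose $(\Gamma_n)_{n\in\mathbb{N}}$ is a graph sequence where $\Gamma_n = (V_n,E_n)$ has $n$ vertices and minimum degree $\delta(\Gamma_n) \geq \varepsilon n$. For each $n$ define $p_0 = p_0(n)$ as the unique solution in the interval $0\leq p\leq 1$ to the equation $$\sum_{v\in V_n} (1-p)^{d_{\Gamma_n}(v)} \log n = 1.$$ Then, as $n\to\infty$, $$\Pr\{\delta(\Gamma_{n,\,p_0 - \omega/n}) \geq 2\} = o(1), \qquad \Pr\{\delta(\Gamma_{n,\,p_0+\omega/n}) \geq 2\} = 1 - o(1).$$
   Context: All graphs are finite and simple; $\delta(G)$ is the minimum degree of $G$ and $d_G(v)$ the degree of $v$ in $G$. For $0\le p\le 1$, $\Gamma_{n,p}$ denotes the random subgraph of $\Gamma_n$ (on the same vertex set) obtained by retaining each edge of $\Gamma_n$ independently with probability $p$. Logarithms are natural. *)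

theory Defs
  imports "HOL-Probability.Probability" "HOL-Library.Landau_Symbols"
begin

definition simple_graph :: "'a set \<Rightarrow> 'a set set \<Rightarrow> bool" where
  "simple_graph V E \<longleftrightarrow> finite V \<and> (\<forall>e\<in>E. e \<subseteq> V \<and> card e = 2)"

definition degree :: "'a set set \<Rightarrow> 'a \<Rightarrow> nat" where
  "degree E v = card {e \<in> E. v \<in> e}"

(* Only meaningful for finite nonempty V. *)
definition min_degree :: "'a set \<Rightarrow> 'a set set \<Rightarrow> nat" where
  "min_degree V E = Min (degree E ` V)"

(* Distribution of the edge set of the random subgraph: one independent Bernoulli(p) indicator per
   edge of the finite set E. Note that bernoulli_pmf clamps p to the interval [0,1]. *)
definition random_subgraph :: "'a set set \<Rightarrow> real \<Rightarrow> 'a set set pmf" where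
  "random_subgraph E p =
     map_pmf (\<lambda>keep. {e \<in> E. keep e}) (Pi_pmf E False (\<lambda>_. bernoulli_pmf p))"

(* The solution exists and is unique as soon as V has at least two vertices and no vertex is
   isolated; otherwise the description is unspecified. *)
definition threshold_p0 :: "'a set \<Rightarrow> 'a set set \<Rightarrow> real" where
  "threshold_p0 V E =
     (THE p. 0 \<le> p \<and> p \<le> 1 \<and>
             (\<Sum>v\<in>V. (1 - p) ^ degree E v * ln (real (card V))) = 1)"

end

theory Submission
  imports Defs "HOL-Real_Asymp.Real_Asymp"
begin

text \<open>
  Write \<open>S(p) = (\<Sum>v. (1 - p) ^ d v)\<close> for the expected number of isolated vertices, so that
  \<open>S(p0) = 1 / ln n\<close>. At \<open>p\<close> of order \<open>ln n / n\<close>, a vertex of degree \<open>d \<ge> \<epsilon> n\<close> is about \<open>d * p\<close>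
  times as likely to have degree one as to be isolated, so the expected number of vertices of degree one is of order
  \<open>n * p * S(p)\<close>, which is of constant order at \<open>p0\<close>. Moving \<open>p\<close> by \<open>w / n\<close> changes \<open>S\<close> by a
  factor that tends to zero or to infinity with \<open>w\<close>: upwards it is at most \<open>exp (- \<epsilon> w)\<close>,
  downwards it is at least \<open>1 + \<epsilon> w\<close> by Bernoulli's inequality. Meanwhile \<open>n * p\<close> stays of order
  \<open>ln n\<close>, because \<open>ln n / (2 n) \<le> p0 \<le> 2 ln n / (\<epsilon> n)\<close> (\<open>threshold_p0_bounds\<close>) and \<open>w\<close> is
  small compared to \<open>ln n\<close>.

  Above the threshold the union bound over vertices of degree zero or one suffices
  (\<open>prob_min_degree_ge_2_ge\<close>). Below it the second moment method shows that some vertex has degree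
  exactly one (\<open>prob_min_degree_ge_2_le\<close>). It is convenient to count not vertices but pairs
  \<open>(v, e)\<close> in which \<open>e\<close> is the only retained edge at \<open>v\<close>: each such event, and each
  nonempty intersection of two of them, prescribes the fate of a fixed set of edges, so its
  probability is a monomial in \<open>p\<close> and \<open>1 - p\<close> (\<open>prob_random_subgraph_retain_avoid\<close>). Two such events at different vertices
  are almost independent, as those vertices share at most one edge.
\<close>

section \<open>The second moment method\<close>

text \<open>
  Chebyshev's inequality for the number of events that occur: if none occurs, this number deviates
  from its mean \<open>\<mu>\<close> by \<open>\<mu>\<close>.
\<close>

lemma (in prob_space) prob_none_le_second_moment:
  assumes "finite I" "\<And>i. i \<in> I \<Longrightarrow> A i \<in> events"
    and \<mu>: "\<mu> = (\<Sum>i\<in>I. prob (A i))" "\<mu> > 0"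
  shows "prob {x \<in> space M. \<forall>i\<in>I. x \<notin> A i}
           \<le> (\<Sum>i\<in>I. \<Sum>j\<in>I. prob (A i \<inter> A j)) / \<mu>\<^sup>2 - 1"
proof -
  define X :: "'a \<Rightarrow> real" where "X x = (\<Sum>i\<in>I. indicator (A i) x)" for x
  have [measurable]: "A i \<in> events" if "i \<in> I" for i
    using assms that by blast
  have X_meas: "random_variable borel X"
    unfolding X_def by (intro borel_measurable_sum borel_measurable_indicator assms)
  have sq: "(X x)\<^sup>2 = (\<Sum>i\<in>I. \<Sum>j\<in>I. indicator (A i \<inter> A j) x)" for x
    by (simp add: X_def power2_eq_square sum_product indicator_inter_arith)
  have int_ind: "integrable M (indicator (A i \<inter> A j) :: _ \<Rightarrow> real)" if "i \<in> I" "j \<in> I" for i j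
    using that by (intro integrable_real_indicator) (auto simp: emeasure_eq_measure)
  have int1: "integrable M (indicator (A i) :: _ \<Rightarrow> real)" if "i \<in> I" for i
    using int_ind[OF that that] by simp
  have intX: "integrable M X"
    unfolding X_def by (intro Bochner_Integration.integrable_sum int1)
  have intX2: "integrable M (\<lambda>x. (X x)\<^sup>2)"
    unfolding sq by (intro Bochner_Integration.integrable_sum int_ind)
  have EX: "expectation X = \<mu>"
    unfolding X_def \<mu>
    by (subst Bochner_Integration.integral_sum)
      (auto intro!: int1 sum.cong simp: assms(2) sets.sets_into_space Int_absorb1)
  have EX2: "expectation (\<lambda>x. (X x)\<^sup>2) = (\<Sum>i\<in>I. \<Sum>j\<in>I. prob (A i \<inter> A j))"
  proof -
    have inner: "expectation (\<lambda>x. \<Sum>j\<in>I. indicator (A i \<inter> A j) x) = (\<Sum>j\<in>I. prob (A i \<inter> A j))"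
      if "i \<in> I" for i
      using that assms(2)[THEN sets.sets_into_space]
      by (subst Bochner_Integration.integral_sum)
        (auto intro!: int_ind sum.cong arg_cong[where f = prob])
    show ?thesis
      unfolding sq
      by (subst Bochner_Integration.integral_sum)
        (auto intro!: int_ind sum.cong Bochner_Integration.integrable_sum inner)
  qed
  have "prob {x \<in> space M. \<forall>i\<in>I. x \<notin> A i}
          \<le> prob {x \<in> space M. \<mu> \<le> \<bar>X x - expectation X\<bar>}"
    using X_meas by (intro finite_measure_mono) (auto simp: EX X_def indicator_def)
  also have "\<dots> \<le> variance X / \<mu>\<^sup>2"
    by (rule Chebyshev_inequality[OF X_meas intX2 \<mu>(2)])
  also have "variance X = (\<Sum>i\<in>I. \<Sum>j\<in>I. prob (A i \<inter> A j)) - \<mu>\<^sup>2"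
    using variance_eq[OF intX intX2] EX EX2 by simp
  finally show ?thesis
    using \<mu>(2) by (simp add: diff_divide_distrib)
qed

section \<open>Events of a random subgraph\<close>

lemma prob_random_subgraph_retain_avoid:
  assumes "finite E" "S \<subseteq> E" "T \<subseteq> E" "S \<inter> T = {}" "0 \<le> p" "p \<le> 1"
  shows "measure_pmf.prob (random_subgraph E p) {F. S \<subseteq> F \<and> F \<inter> T = {}}
           = p ^ card S * (1 - p) ^ card T"
proof -
  define B where "B e = (if e \<in> S then {True} else if e \<in> T then {False} else UNIV)" for e
  have "measure_pmf.prob (random_subgraph E p) {F. S \<subseteq> F \<and> F \<inter> T = {}}
      = measure_pmf.prob (Pi_pmf E False (\<lambda>_. bernoulli_pmf p)) (Pi E B)"
    unfolding random_subgraph_def measure_map_pmf using assms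
    by (intro arg_cong2[where f = measure] refl) (auto simp: B_def Pi_def)
  also have "\<dots> = (\<Prod>e\<in>E. measure_pmf.prob (bernoulli_pmf p) (B e))"
    by (rule measure_Pi_pmf_Pi) fact
  also have "\<dots> = (\<Prod>e\<in>E. if e \<in> S then p else if e \<in> T then 1 - p else 1)"
    using assms by (intro prod.cong) (auto simp: B_def measure_pmf_single)
  also have "\<dots> = (\<Prod>e\<in>S \<union> T. if e \<in> S then p else 1 - p)"
    using assms by (intro prod.mono_neutral_cong_right) auto
  also have "\<dots> = p ^ card S * (1 - p) ^ card T"
  proof (subst prod.union_disjoint)
    show "(\<Prod>e\<in>S. if e \<in> S then p else 1 - p) * (\<Prod>e\<in>T. if e \<in> S then p else 1 - p)
       = p ^ card S * (1 - p) ^ card T"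
    proof -
      have "(\<Prod>e\<in>T. if e \<in> S then p else 1 - p) = (\<Prod>e\<in>T. 1 - p)"
        using assms by (intro prod.cong) auto
      then show ?thesis by simp
    qed
  qed (use assms finite_subset in auto)
  finally show ?thesis .
qed


definition incident :: "'a set set \<Rightarrow> 'a \<Rightarrow> 'a set set" where
  "incident E v = {e \<in> E. v \<in> e}"

definition sole_edge :: "'a \<Rightarrow> 'a set \<Rightarrow> 'a set set set" where
  "sole_edge v e = {F. incident F v = {e}}"

lemma degree_eq_card_incident: "degree E v = card (incident E v)"
  by (simp add: degree_def incident_def)

lemma incident_subset: "incident E v \<subseteq> E"
  by (auto simp: incident_def)

lemma min_degree_ge_iff:
  assumes "finite V" "V \<noteq> {}"
  shows "k \<le> min_degree V F \<longleftrightarrow> (\<forall>v\<in>V. k \<le> degree F v)"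
  using assms by (simp add: min_degree_def)

lemma simple_graph_finite_edges:
  assumes "simple_graph V E"
  shows "finite E"
proof -
  have "E \<subseteq> Pow V" "finite V" using assms by (auto simp: simple_graph_def)
  then show ?thesis by (meson finite_Pow_iff finite_subset)
qed

lemma degree_le_card_vertices:
  assumes "simple_graph V E"
  shows "degree E v \<le> card V"
proof -
  have "incident E v \<subseteq> (\<lambda>u. {v, u}) ` V"
  proof
    fix e assume "e \<in> incident E v"
    then have e: "v \<in> e" "e \<subseteq> V" "card e = 2"
      using assms by (auto simp: incident_def simple_graph_def)
    then obtain a b where "e = {a, b}" by (auto simp: card_2_iff)
    with e show "e \<in> (\<lambda>u. {v, u}) ` V" by auto
  qed
  moreover have "finite V" using assms by (simp add: simple_graph_def)
  ultimately show ?thesis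
    unfolding degree_eq_card_incident
    by (meson card_image_le card_mono finite_imageI le_trans)
qed

lemma card_common_incident_le_1:
  assumes "simple_graph V E" "u \<noteq> v"
  shows "card (incident E u \<inter> incident E v) \<le> 1"
proof -
  have "incident E u \<inter> incident E v \<subseteq> {{u, v}}"
  proof
    fix e assume "e \<in> incident E u \<inter> incident E v"
    then have "card e = 2" "u \<in> e" "v \<in> e"
      using assms by (auto simp: incident_def simple_graph_def)
    then show "e \<in> {{u, v}}" using assms(2) by (auto simp: card_2_iff)
  qed
  then show ?thesis using card_mono[of "{{u, v}}"] by simp
qed

lemma set_random_subgraph_subset: "set_pmf (random_subgraph E p) \<subseteq> Pow E"
  by (auto simp: random_subgraph_def)

text \<open>
  Events are sets of arbitrary edge sets, but only subsets of \<open>E\<close> carry mass; this lets events be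
  compared on those alone.
\<close>

lemma prob_random_subgraph_mono:
  assumes "\<And>F. F \<subseteq> E \<Longrightarrow> F \<in> A \<Longrightarrow> F \<in> B"
  shows "measure_pmf.prob (random_subgraph E p) A \<le> measure_pmf.prob (random_subgraph E p) B"
  using set_random_subgraph_subset[of E p] assms
  by (intro measure_pmf.finite_measure_mono_AE) (auto simp: AE_measure_pmf_iff)

lemma prob_sole_edge:
  assumes "finite E" "e \<in> incident E v" "0 \<le> p" "p \<le> 1"
  shows "measure_pmf.prob (random_subgraph E p) (sole_edge v e) = p * (1 - p) ^ (degree E v - 1)"
proof -
  let ?R = "{F. {e} \<subseteq> F \<and> F \<inter> (incident E v - {e}) = {}}"
  have iff: "F \<in> sole_edge v e \<longleftrightarrow> F \<in> ?R" if "F \<subseteq> E" for F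
    using that assms(2) by (auto simp: sole_edge_def incident_def)
  have "measure_pmf.prob (random_subgraph E p) (sole_edge v e) = measure_pmf.prob (random_subgraph E p) ?R"
    by (intro antisym prob_random_subgraph_mono) (use iff in blast)+
  also have "\<dots> = p ^ card {e} * (1 - p) ^ card (incident E v - {e})"
    using assms incident_subset[of E v] by (intro prob_random_subgraph_retain_avoid) auto
  also have "card (incident E v - {e}) = degree E v - 1"
    using assms by (simp add: degree_eq_card_incident)
  finally show ?thesis by simp
qed

text \<open>
  If \<open>e\<close> and \<open>f\<close> differ, the bound is the product of the two single probabilities up to the factor
  \<open>1 / (1 - p)\<close>, the price of counting an edge between \<open>u\<close> and \<open>v\<close> only once. If \<open>e = f\<close>, only one
  edge has to be retained, so the bound exceeds the product by a factor \<open>1 / p\<close>; but this occurs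
  for at most one edge per pair of vertices. When \<open>e\<close> or \<open>f\<close> alone joins \<open>u\<close> and \<open>v\<close>, the two
  events are incompatible, and the bound holds a fortiori.
\<close>

lemma prob_two_sole_edges_le:
  assumes G: "simple_graph V E" and e: "e \<in> incident E v" and f: "f \<in> incident E u"
    and uv: "v \<noteq> u" and p: "0 < p" "p < 1"
  shows "measure_pmf.prob (random_subgraph E p) (sole_edge v e \<inter> sole_edge u f)
    \<le> (if e = f then p else p\<^sup>2 / (1 - p)) * (1 - p) ^ (degree E v - 1) * (1 - p) ^ (degree E u - 1)"
proof -
  have finE: "finite E" by (rule simple_graph_finite_edges[OF G])
  have fin: "finite (incident E w)" for w
    using finE incident_subset finite_subset by metis
  let ?U = "incident E v \<union> incident E u"
  let ?R = "{F. {e, f} \<subseteq> F \<and> F \<inter> (?U - {e, f}) = {}}"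
  have "measure_pmf.prob (random_subgraph E p) (sole_edge v e \<inter> sole_edge u f)
      \<le> measure_pmf.prob (random_subgraph E p) ?R"
    by (rule prob_random_subgraph_mono) (auto simp: sole_edge_def incident_def)
  also have "\<dots> = p ^ card {e, f} * (1 - p) ^ card (?U - {e, f})"
    using e f p finE incident_subset[of E v] incident_subset[of E u]
    by (intro prob_random_subgraph_retain_avoid) auto
  finally have le: "measure_pmf.prob (random_subgraph E p) (sole_edge v e \<inter> sole_edge u f)
      \<le> p ^ card {e, f} * (1 - p) ^ card (?U - {e, f})" .
  have cU: "degree E v + degree E u \<le> card ?U + 1"
    using card_Un_Int[OF fin[of v] fin[of u]] card_common_incident_le_1[OF G uv]
    by (simp add: degree_eq_card_incident)
  have cT: "card (?U - {e, f}) = card ?U - card {e, f}"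
    using e f by (intro card_Diff_subset) auto
  have deg: "degree E v > 0" "degree E u > 0"
    using e f fin by (auto simp: degree_eq_card_incident card_gt_0_iff)
  show ?thesis
  proof (cases "e = f")
    case True
    have "(1 - p) ^ card (?U - {e, f}) \<le> (1 - p) ^ ((degree E v - 1) + (degree E u - 1))"
      using p cT cU deg True by (intro power_decreasing) auto
    then show ?thesis using le p True
      by (auto simp: power_add mult.assoc intro: order_trans mult_left_mono)
  next
    case False
    have "(1 - p) ^ (card (?U - {e, f}) + 1) \<le> (1 - p) ^ ((degree E v - 1) + (degree E u - 1))"
      using p cT cU deg False by (intro power_decreasing) auto
    then have "(1 - p) ^ card (?U - {e, f})
        \<le> (1 - p) ^ (degree E v - 1) * (1 - p) ^ (degree E u - 1) / (1 - p)"
      using p by (simp add: power_add pos_le_divide_eq mult.commute)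
    then have "p\<^sup>2 * (1 - p) ^ card (?U - {e, f})
        \<le> p\<^sup>2 * ((1 - p) ^ (degree E v - 1) * (1 - p) ^ (degree E u - 1) / (1 - p))"
      by (rule mult_left_mono) simp
    then show ?thesis using le False by (simp add: power2_eq_square mult_ac)
  qed
qed

section \<open>Bounds on the probability of minimum degree two\<close>

text \<open>
  Here \<open>\<mu>\<close> is the expected number of vertices of degree one. The three error terms of the second
  moment method come from the diagonal, from the factor \<open>1 / (1 - p)\<close> for distinct edges, and from
  pairs of vertices whose sole retained edge is the same. The last contribution is at most
  \<open>p * S\<^sup>2\<close> with \<open>S = (\<Sum>v. (1 - p) ^ (d v - 1))\<close>, while \<open>\<mu> \<ge> p * D * S\<close>.
\<close>

lemma prob_min_degree_ge_2_le:
  assumes G: "simple_graph V E" "V \<noteq> {}" and p: "0 < p" "p < 1"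
    and D: "D > 0" "\<And>v. v \<in> V \<Longrightarrow> D \<le> real (degree E v)"
    and \<mu>: "\<mu> = (\<Sum>v\<in>V. real (degree E v) * (p * (1 - p) ^ (degree E v - 1)))"
  shows "measure_pmf.prob (random_subgraph E p) {F. min_degree V F \<ge> 2}
    \<le> 1 / \<mu> + p / (1 - p) + 1 / (p * D\<^sup>2)"
proof -
  define c where "c v = (1 - p) ^ (degree E v - 1)" for v
  define m where "m = (\<lambda>(v, e :: 'a set). p * c v)"
  define I where "I = Sigma V (incident E)"
  define A where "A = (\<lambda>(v, e). sole_edge v e :: 'a set set set)"
  let ?P = "measure_pmf.prob (random_subgraph E p)"
  have finE: "finite E" by (rule simple_graph_finite_edges[OF G(1)])
  have finV: "finite V" using G by (simp add: simple_graph_def)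
  have fin [simp]: "finite (incident E w)" for w
    using finE incident_subset finite_subset by metis
  have finI: "finite I" using finV by (auto simp: I_def)
  have sum_I: "(\<Sum>i\<in>I. g i) = (\<Sum>v\<in>V. \<Sum>e\<in>incident E v. g (v, e))" for g :: "_ \<Rightarrow> real"
    unfolding I_def using finV by (subst sum.Sigma) auto
  have c_pos: "c v > 0" for v using p by (simp add: c_def)
  have PA: "?P (A i) = m i" if "i \<in> I" for i
    using that p finE by (auto simp: A_def m_def I_def c_def prob_sole_edge)
  have sum_m: "(\<Sum>i\<in>I. m i) = \<mu>"
  proof -
    have "(\<Sum>i\<in>I. m i) = (\<Sum>v\<in>V. \<Sum>e\<in>incident E v. p * c v)"
      by (simp only: sum_I m_def prod.case)
    then show ?thesis by (simp add: \<mu> c_def degree_eq_card_incident)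
  qed
  define S where "S = (\<Sum>v\<in>V. c v)"
  have S_pos: "S > 0" unfolding S_def using finV G c_pos by (intro sum_pos) auto
  have \<mu>_ge: "p * D * S \<le> \<mu>"
    unfolding \<mu> S_def sum_distrib_left c_def using p D
    by (intro sum_mono) (auto simp: mult_ac intro!: mult_left_mono mult_right_mono)
  have \<mu>_pos: "\<mu> > 0" using \<mu>_ge S_pos p D by (smt (verit) mult_pos_pos)

  \<comment> \<open>The pairs counted here have one and the same edge as the sole retained edge of both ends.\<close>
  let ?shared = "\<lambda>i j. if fst i \<noteq> fst j \<and> snd i = snd j then p * (c (fst i) * c (fst j)) else 0"
  have pair: "?P (A i \<inter> A j) \<le> (if i = j then m i else 0) + m i * m j / (1 - p) + ?shared i j"
    if ij: "i \<in> I" "j \<in> I" for i j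
  proof -
    obtain v e u f where eq: "i = (v, e)" "j = (u, f)" by (metis surj_pair)
    have m0: "m i * m j / (1 - p) \<ge> 0" using p c_pos by (simp add: m_def eq less_imp_le)
    have mem: "e \<in> incident E v" "f \<in> incident E u" using ij by (auto simp: I_def eq)
    consider "i = j" | "v = u" "e \<noteq> f" | "v \<noteq> u" using eq by auto
    then show ?thesis
    proof cases
      case 1 then show ?thesis using m0 PA ij by auto
    next
      case 2
      then have "A i \<inter> A j = {}" by (auto simp: A_def eq sole_edge_def)
      then show ?thesis using m0 2 by (auto simp: eq)
    next
      case 3
      have "?P (A i \<inter> A j) \<le> (if e = f then p else p\<^sup>2 / (1 - p)) * c v * c u"
        using prob_two_sole_edges_le[OF G(1) mem 3 p] by (simp add: A_def eq c_def)
      then show ?thesis using 3 m0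
        by (cases "e = f") (auto simp: eq m_def power2_eq_square mult_ac)
    qed
  qed
  have diag: "(\<Sum>i\<in>I. \<Sum>j\<in>I. if i = j then m i else 0) = \<mu>"
    using finI sum_m by (simp add: sum.delta')
  have prods: "(\<Sum>i\<in>I. \<Sum>j\<in>I. m i * m j / (1 - p)) = \<mu>\<^sup>2 / (1 - p)"
    by (simp add: sum_m[symmetric] power2_eq_square sum_product sum_divide_distrib)
  have shared: "(\<Sum>i\<in>I. \<Sum>j\<in>I. ?shared i j) \<le> p * S\<^sup>2"
  proof -
    have "(\<Sum>i\<in>I. \<Sum>j\<in>I. ?shared i j)
        = (\<Sum>v\<in>V. \<Sum>e\<in>incident E v. \<Sum>u\<in>V. \<Sum>f\<in>incident E u. ?shared (v, e) (u, f))"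
      by (simp only: sum_I)
    also have "\<dots> = (\<Sum>v\<in>V. \<Sum>u\<in>V. \<Sum>e\<in>incident E v. \<Sum>f\<in>incident E u. ?shared (v, e) (u, f))"
      by (intro sum.cong refl sum.swap)
    also have "\<dots> \<le> (\<Sum>v\<in>V. \<Sum>u\<in>V. p * (c v * c u))"
    proof (intro sum_mono)
      fix v u
      show "(\<Sum>e\<in>incident E v. \<Sum>f\<in>incident E u. ?shared (v, e) (u, f)) \<le> p * (c v * c u)"
      proof (cases "v = u")
        case True
        then show ?thesis using p c_pos by (simp add: less_imp_le)
      next
        case False
        have "(\<Sum>e\<in>incident E v. \<Sum>f\<in>incident E u. ?shared (v, e) (u, f))
           = (\<Sum>e\<in>incident E v. if e \<in> incident E u then p * (c v * c u) else 0)"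
          using False by (simp only: fst_conv snd_conv) simp
        also have "\<dots> = real (card (incident E v \<inter> incident E u)) * (p * (c v * c u))"
          by (simp add: sum.inter_restrict[symmetric])
        also have "\<dots> \<le> 1 * (p * (c v * c u))"
          using card_common_incident_le_1[OF G(1) False] p c_pos
          by (intro mult_right_mono) (auto simp: less_imp_le)
        finally show ?thesis by simp
      qed
    qed
    also have "\<dots> = p * S\<^sup>2"
      unfolding S_def power2_eq_square sum_product by (simp only: sum_distrib_left)
    finally show ?thesis .
  qed
  have "(\<Sum>i\<in>I. \<Sum>j\<in>I. ?P (A i \<inter> A j))
      \<le> (\<Sum>i\<in>I. \<Sum>j\<in>I. (if i = j then m i else 0) + m i * m j / (1 - p) + ?shared i j)"
    by (intro sum_mono pair)
  also have "\<dots> \<le> \<mu> + \<mu>\<^sup>2 / (1 - p) + p * S\<^sup>2"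
    using diag prods shared by (simp only: sum.distrib)
  finally have second: "(\<Sum>i\<in>I. \<Sum>j\<in>I. ?P (A i \<inter> A j)) \<le> \<mu> + \<mu>\<^sup>2 / (1 - p) + p * S\<^sup>2" .

  have "?P {F. min_degree V F \<ge> 2} \<le> ?P {F. \<forall>i\<in>I. F \<notin> A i}"
  proof (rule prob_random_subgraph_mono, safe)
    fix F v e assume "2 \<le> min_degree V F" "(v, e) \<in> I" "F \<in> A (v, e)"
    then have "2 \<le> degree F v" "degree F v = 1"
      using min_degree_ge_iff[OF finV G(2)]
      by (auto simp: I_def A_def sole_edge_def degree_eq_card_incident)
    then show False by simp
  qed
  also have "\<dots> \<le> (\<Sum>i\<in>I. \<Sum>j\<in>I. ?P (A i \<inter> A j)) / \<mu>\<^sup>2 - 1"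
    using measure_pmf.prob_none_le_second_moment[OF finI, of A "random_subgraph E p" \<mu>]
      \<mu>_pos sum_m PA by simp
  also have "\<dots> \<le> (\<mu> + \<mu>\<^sup>2 / (1 - p) + p * S\<^sup>2) / \<mu>\<^sup>2 - 1"
    using second \<mu>_pos by (simp add: divide_right_mono)
  also have "\<dots> = 1 / \<mu> + p / (1 - p) + p * S\<^sup>2 / \<mu>\<^sup>2"
    using \<mu>_pos p by (simp add: field_simps power2_eq_square)
  also have "p * S\<^sup>2 / \<mu>\<^sup>2 \<le> p * S\<^sup>2 / (p * D * S)\<^sup>2"
    using \<mu>_ge \<mu>_pos p D(1) S_pos
    by (intro divide_left_mono power_mono mult_pos_pos zero_less_power) auto
  also have "\<dots> = 1 / (p * D\<^sup>2)"
    using p D S_pos by (simp add: field_simps power2_eq_square)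
  finally show ?thesis by simp
qed

lemma prob_min_degree_ge_2_ge:
  assumes G: "simple_graph V E" "V \<noteq> {}" and p: "0 \<le> p" "p \<le> 1"
  shows "1 - (\<Sum>v\<in>V. (1 - p) ^ degree E v + real (degree E v) * (p * (1 - p) ^ (degree E v - 1)))
    \<le> measure_pmf.prob (random_subgraph E p) {F. min_degree V F \<ge> 2}"
proof -
  let ?P = "measure_pmf.prob (random_subgraph E p)"
  let ?B = "\<lambda>v. {F. F \<inter> incident E v = {}} \<union> (\<Union>e\<in>incident E v. sole_edge v e)"
  have finE: "finite E" by (rule simple_graph_finite_edges[OF G(1)])
  have finV: "finite V" using G by (simp add: simple_graph_def)
  have fin [simp]: "finite (incident E w)" for w
    using finE incident_subset finite_subset by metis
  have bad: "?P (?B v) \<le> (1 - p) ^ degree E v + real (degree E v) * (p * (1 - p) ^ (degree E v - 1))" for v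
  proof -
    have "?P (?B v) \<le> ?P {F. F \<inter> incident E v = {}} + ?P (\<Union>e\<in>incident E v. sole_edge v e)"
      by (rule measure_Un_le) auto
    also have "?P {F. F \<inter> incident E v = {}} = (1 - p) ^ degree E v"
      using prob_random_subgraph_retain_avoid[OF finE, of "{}" "incident E v" p] p incident_subset[of E v]
      by (simp add: degree_eq_card_incident)
    also have "?P (\<Union>e\<in>incident E v. sole_edge v e) \<le> (\<Sum>e\<in>incident E v. ?P (sole_edge v e))"
      by (rule measure_pmf.finite_measure_subadditive_finite) auto
    also have "\<dots> = (\<Sum>e\<in>incident E v. p * (1 - p) ^ (degree E v - 1))"
      using finE p by (intro sum.cong refl prob_sole_edge) auto
    finally show ?thesis by (simp add: degree_eq_card_incident)
  qed
  have "1 - ?P {F. min_degree V F \<ge> 2} = ?P (- {F. min_degree V F \<ge> 2})"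
    using measure_pmf.prob_compl[of "{F. min_degree V F \<ge> 2}" "random_subgraph E p"]
    by (simp add: Compl_eq_Diff_UNIV)
  also have "\<dots> \<le> ?P (\<Union>v\<in>V. ?B v)"
  proof (rule prob_random_subgraph_mono)
    fix F assume F: "F \<subseteq> E" "F \<in> - {F. min_degree V F \<ge> 2}"
    then obtain v where v: "v \<in> V" "degree F v < 2"
      using min_degree_ge_iff[OF finV G(2)] by (auto simp: not_le)
    have sub: "incident F v \<subseteq> incident E v" using F by (auto simp: incident_def)
    then have "finite (incident F v)" using fin finite_subset by blast
    then have "incident F v = {} \<or> (\<exists>e. incident F v = {e})"
      using v by (auto simp: degree_eq_card_incident less_2_cases_iff card_1_singleton_iff)
    then show "F \<in> (\<Union>v\<in>V. ?B v)"
    proof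
      assume "incident F v = {}"
      then have "F \<inter> incident E v = {}" by (auto simp: incident_def)
      with v show ?thesis by blast
    next
      assume "\<exists>e. incident F v = {e}"
      with sub v show ?thesis by (auto simp: sole_edge_def)
    qed
  qed
  also have "\<dots> \<le> (\<Sum>v\<in>V. ?P (?B v))"
    using finV by (intro measure_pmf.finite_measure_subadditive_finite) auto
  also have "\<dots> \<le> (\<Sum>v\<in>V. (1 - p) ^ degree E v + real (degree E v) * (p * (1 - p) ^ (degree E v - 1)))"
    by (intro sum_mono bad)
  finally show ?thesis by simp
qed


section \<open>The threshold\<close>

text \<open>
  The defining sum is strictly decreasing on \<open>[0, 1]\<close> and falls there from \<open>n * ln n\<close> to \<open>0\<close>.
\<close>

lemma threshold_p0_solves:
  assumes fin: "finite V" and n: "ln (real (card V)) \<ge> 1"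
    and deg: "\<And>v. v \<in> V \<Longrightarrow> degree E v > 0"
  shows "0 \<le> threshold_p0 V E" "threshold_p0 V E \<le> 1"
    "(\<Sum>v\<in>V. (1 - threshold_p0 V E) ^ degree E v) * ln (real (card V)) = 1"
proof -
  let ?L = "ln (real (card V))"
  let ?f = "\<lambda>p. \<Sum>v\<in>V. (1 - p) ^ degree E v * ?L"
  have ne: "V \<noteq> {}" using n by auto
  have card: "real (card V) \<ge> 1" using fin ne by (simp add: Suc_le_eq card_gt_0_iff)
  have "\<exists>p. 0 \<le> p \<and> p \<le> 1 \<and> ?f p = 1"
  proof (rule IVT2')
    have "?f 1 = 0" using deg by (intro sum.neutral) auto
    then show "?f 1 \<le> 1" by simp
    have "1 * 1 \<le> real (card V) * ?L" using card n by (intro mult_mono) auto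
    then show "1 \<le> ?f 0" by simp
  qed (auto intro!: continuous_intros)
  moreover have "?f q < ?f p" if "0 \<le> p" "p < q" "q \<le> 1" for p q
    using that fin ne deg n
    by (intro sum_strict_mono mult_strict_right_mono power_strict_mono) auto
  ultimately have "\<exists>!p. 0 \<le> p \<and> p \<le> 1 \<and> ?f p = 1"
    by (metis less_irrefl linorder_neqE_linordered_idom)
  from theI'[OF this, folded threshold_p0_def]
  show "0 \<le> threshold_p0 V E" "threshold_p0 V E \<le> 1"
    "(\<Sum>v\<in>V. (1 - threshold_p0 V E) ^ degree E v) * ?L = 1"
    by (auto simp: sum_distrib_right)
qed

text \<open>
  Since degrees lie between \<open>D\<close> and \<open>n\<close>, the sum \<open>S(p0) = 1 / ln n\<close> lies between
  \<open>n * (1 - p0) ^ n\<close> and \<open>n * exp (- D * p0)\<close>. The factor two in the upper bound absorbs the term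
  \<open>ln (ln n)\<close>; in the lower bound it comes from \<open>1 - p \<ge> exp (- 2 p)\<close> on \<open>[0, 1/2]\<close>.
\<close>

lemma threshold_p0_bounds:
  assumes G: "simple_graph V E" and n: "ln (real (card V)) \<ge> 1"
    and D: "D > 0" "\<And>v. v \<in> V \<Longrightarrow> D \<le> real (degree E v)"
  shows "threshold_p0 V E \<le> 2 * ln (real (card V)) / D"
    "ln (real (card V)) / (2 * real (card V)) \<le> threshold_p0 V E"
proof -
  let ?n = "real (card V)" and ?p = "threshold_p0 V E"
  have fin: "finite V" using G by (simp add: simple_graph_def)
  have deg: "degree E v > 0" if "v \<in> V" for v using D(1) D(2)[OF that] by linarith
  note p = threshold_p0_solves[OF fin n deg]
  have npos: "?n > 0" using n by (cases "card V = 0") auto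
  have ln_le: "ln ?n \<le> ?n" using ln_le_minus_one[OF npos] by linarith
  have upper: "(1 - ?p) ^ degree E v \<le> exp (- (D * ?p))" if "v \<in> V" for v
  proof -
    have "(1 - ?p) ^ degree E v \<le> exp (- ?p) ^ degree E v"
      using p exp_ge_add_one_self[of "- ?p"] by (intro power_mono) auto
    also have "\<dots> = exp (- (real (degree E v) * ?p))" by (simp add: exp_of_nat_mult[symmetric])
    also have "\<dots> \<le> exp (- (D * ?p))" using D(2)[OF that] p by (simp add: mult_right_mono)
    finally show ?thesis .
  qed
  have "1 = (\<Sum>v\<in>V. (1 - ?p) ^ degree E v) * ln ?n" using p(3) by simp
  also have "\<dots> \<le> (\<Sum>v\<in>V. exp (- (D * ?p))) * ln ?n"
    using n by (intro mult_right_mono sum_mono upper) auto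
  also have "\<dots> = ?n * exp (- (D * ?p)) * ln ?n" by simp
  also have "\<dots> \<le> ?n * exp (- (D * ?p)) * ?n" using ln_le npos by (intro mult_left_mono) auto
  finally have "exp (D * ?p) \<le> ?n * ?n"
    by (simp add: exp_minus field_simps)
  then have "D * ?p \<le> ln (?n * ?n)" using npos by (simp add: ln_ge_iff)
  then have "D * ?p \<le> 2 * ln ?n" using npos by (simp add: ln_mult)
  then show "?p \<le> 2 * ln ?n / D" using D(1) by (simp add: field_simps)
  show "ln ?n / (2 * ?n) \<le> ?p"
  proof (cases "?p \<le> 1/2")
    case False
    have "ln ?n / (2 * ?n) \<le> 1/2" using ln_le npos by (simp add: field_simps)
    with False show ?thesis by linarith
  next
    case True
    have "?p * ?p \<le> ?p * (1/2)" using True p by (intro mult_left_mono) auto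
    then have "- 2 * ?p \<le> ln (1 - ?p)"
      using ln_one_minus_pos_lower_bound[OF p(1) True] by (simp add: power2_eq_square)
    then have base: "exp (- (2 * ?p)) \<le> 1 - ?p" using True by (simp add: ln_ge_iff)
    have lower: "exp (- (2 * ?n * ?p)) \<le> (1 - ?p) ^ degree E v" for v
    proof -
      have "exp (- (2 * ?n * ?p)) = exp (- (2 * ?p)) ^ card V"
        by (simp add: exp_of_nat_mult[symmetric] mult_ac)
      also have "\<dots> \<le> (1 - ?p) ^ card V" using base by (intro power_mono) auto
      also have "\<dots> \<le> (1 - ?p) ^ degree E v"
        using degree_le_card_vertices[OF G, of v] p by (intro power_decreasing) auto
      finally show ?thesis .
    qed
    have "?n * exp (- (2 * ?n * ?p)) * 1 \<le> (\<Sum>v\<in>V. exp (- (2 * ?n * ?p))) * ln ?n"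
      using n by (subst sum_constant, intro mult_left_mono) auto
    also have "\<dots> \<le> (\<Sum>v\<in>V. (1 - ?p) ^ degree E v) * ln ?n"
      using n by (intro mult_right_mono sum_mono lower) auto
    also have "\<dots> = 1" by (rule p(3))
    finally have "?n \<le> exp (2 * ?n * ?p)" by (simp add: exp_minus field_simps)
    then have "ln ?n \<le> 2 * ?n * ?p" using npos by (metis exp_ln exp_le_cancel_iff)
    then show ?thesis using npos by (simp add: field_simps)
  qed
qed

text \<open>
  Both perturbation estimates rest on comparing \<open>1 - p \<plusminus> \<delta>\<close> with \<open>(1 - p) * (1 \<plusminus> \<delta>)\<close>, and so turn
  an additive change of \<open>p\<close> into a factor common to all vertices.
\<close>

lemma nonedge_sum_increase:
  fixes p \<delta> D :: real
  assumes "0 \<le> p" "p \<le> 1" "0 \<le> \<delta>" "\<And>v. v \<in> V \<Longrightarrow> D \<le> real (d v)"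
  shows "(1 + D * \<delta>) * (\<Sum>v\<in>V. (1 - p) ^ d v) \<le> (\<Sum>v\<in>V. (1 - (p - \<delta>)) ^ d v)"
  unfolding sum_distrib_left
proof (rule sum_mono)
  fix v assume v: "v \<in> V"
  have "(1 + D * \<delta>) * (1 - p) ^ d v \<le> (1 + real (d v) * \<delta>) * (1 - p) ^ d v"
    using assms v by (auto intro!: mult_right_mono)
  also have "\<dots> \<le> (1 + \<delta>) ^ d v * (1 - p) ^ d v"
    using assms by (intro mult_right_mono Bernoulli_inequality) auto
  also have "\<dots> = ((1 + \<delta>) * (1 - p)) ^ d v" by (simp add: power_mult_distrib)
  also have "\<dots> \<le> (1 - (p - \<delta>)) ^ d v"
    using assms mult_left_mono[of p 1 \<delta>] by (intro power_mono) (auto simp: algebra_simps)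
  finally show "(1 + D * \<delta>) * (1 - p) ^ d v \<le> (1 - (p - \<delta>)) ^ d v" .
qed

lemma nonedge_sum_decrease:
  fixes p \<delta> D :: real
  assumes "0 \<le> p" "p + \<delta> \<le> 1" "0 \<le> \<delta>" "\<And>v. v \<in> V \<Longrightarrow> D \<le> real (d v)"
  shows "(\<Sum>v\<in>V. (1 - (p + \<delta>)) ^ d v) \<le> exp (- (D * \<delta>)) * (\<Sum>v\<in>V. (1 - p) ^ d v)"
  unfolding sum_distrib_left
proof (rule sum_mono)
  fix v assume v: "v \<in> V"
  have "1 - (p + \<delta>) \<le> (1 - \<delta>) * (1 - p)" using assms by (simp add: algebra_simps)
  also have "\<dots> \<le> exp (- \<delta>) * (1 - p)"
    using assms exp_ge_add_one_self[of "- \<delta>"] by (intro mult_right_mono) auto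
  finally have "(1 - (p + \<delta>)) ^ d v \<le> (exp (- \<delta>) * (1 - p)) ^ d v"
    using assms by (intro power_mono) auto
  also have "\<dots> = exp (- (real (d v) * \<delta>)) * (1 - p) ^ d v"
    by (simp add: power_mult_distrib exp_of_nat_mult[symmetric])
  also have "\<dots> \<le> exp (- (D * \<delta>)) * (1 - p) ^ d v"
    using assms v by (auto intro!: mult_right_mono)
  finally show "(1 - (p + \<delta>)) ^ d v \<le> exp (- (D * \<delta>)) * (1 - p) ^ d v" .
qed

section \<open>The two sides of the threshold\<close>

text \<open>
  Below the threshold \<open>n * p \<ge> ln n / 4\<close> and \<open>S(p) \<ge> (1 + \<epsilon> w) / ln n\<close>, so the expected number of
  vertices of degree one is at least \<open>\<epsilon> * (1 + \<epsilon> w) / 4\<close>.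
\<close>

lemma prob_below_threshold_le:
  fixes w \<epsilon> :: real
  assumes G: "simple_graph V E" and n: "n = real (card V)" "ln n \<ge> 1"
    and \<epsilon>: "\<epsilon> > 0" "\<And>v. v \<in> V \<Longrightarrow> \<epsilon> * n \<le> real (degree E v)"
    and w: "0 \<le> w" "w \<le> ln n / 4" and small: "2 * ln n / (\<epsilon> * n) \<le> 1/2"
  shows "measure_pmf.prob (random_subgraph E (threshold_p0 V E - w / n)) {F. min_degree V F \<ge> 2}
    \<le> 4 / (\<epsilon> * (1 + \<epsilon> * w)) + 4 * ln n / (\<epsilon> * n) + 4 / (\<epsilon>\<^sup>2 * n * ln n)"
proof -
  define p0 where "p0 = threshold_p0 V E"
  define p where "p = p0 - w / n"
  define S where "S = (\<Sum>v\<in>V. (1 - p) ^ degree E v)"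
  define \<mu> where "\<mu> = (\<Sum>v\<in>V. real (degree E v) * (p * (1 - p) ^ (degree E v - 1)))"
  have npos: "n > 0" using n by (cases "card V = 0") auto
  have fin: "finite V" and ne: "V \<noteq> {}" using G npos n by (auto simp: simple_graph_def)
  have Dpos: "\<epsilon> * n > 0" using \<epsilon> npos by simp
  have deg: "degree E v > 0" if "v \<in> V" for v using Dpos \<epsilon>(2)[OF that] by linarith
  note p0 = threshold_p0_solves[OF fin n(2)[unfolded n(1)] deg, folded p0_def n(1)]
  note p0b = threshold_p0_bounds[OF G n(2)[unfolded n(1)], folded n(1) p0_def, OF Dpos \<epsilon>(2)]
  have "w / n \<le> ln n / (4 * n)" using w npos by (simp add: field_simps)
  then have p_ge: "ln n / (4 * n) \<le> p" using p0b(2) by (simp add: p_def field_simps)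
  have p_le: "p \<le> 2 * ln n / (\<epsilon> * n)" using p0b(1) w npos by (simp add: p_def)
      (smt (verit) divide_nonneg_pos)
  have p_pos: "p > 0" using p_ge n npos by (smt (verit) divide_pos_pos)
  have p_half: "p \<le> 1/2" using p_le small by linarith
  have "(1 + \<epsilon> * w) * (\<Sum>v\<in>V. (1 - p0) ^ degree E v) \<le> S"
    using nonedge_sum_increase[of p0 "w / n" V "\<epsilon> * n" "degree E"] p0 w npos \<epsilon>
    by (simp add: S_def p_def)
  then have S_ge: "(1 + \<epsilon> * w) / ln n \<le> S"
    using p0(3) n(2) by (simp add: eq_divide_eq[symmetric] nonzero_eq_divide_eq[symmetric])
  have "\<epsilon> * (1 + \<epsilon> * w) / 4 = (\<epsilon> * n) * (ln n / (4 * n)) * ((1 + \<epsilon> * w) / ln n)"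
  proof -
    have "ln n \<noteq> 0" using n(2) by linarith
    then show ?thesis using npos by (simp del: ln_eq_zero_iff add: divide_simps)
  qed
  also have "\<dots> \<le> (\<epsilon> * n) * p * S"
    using p_ge S_ge \<epsilon> npos p_pos w n by (intro mult_mono mult_left_mono) auto
  also have "\<dots> \<le> \<mu>"
    unfolding \<mu>_def S_def sum_distrib_left
  proof (rule sum_mono)
    fix v assume v: "v \<in> V"
    have "\<epsilon> * n * (p * (1 - p) ^ degree E v) \<le> real (degree E v) * (p * (1 - p) ^ (degree E v - 1))"
      using \<epsilon>(2)[OF v] p_pos p_half
      by (intro mult_mono mult_left_mono power_decreasing) auto
    then show "\<epsilon> * n * p * (1 - p) ^ degree E v \<le> real (degree E v) * (p * (1 - p) ^ (degree E v - 1))"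
      by (simp add: mult_ac)
  qed
  finally have \<mu>_ge: "\<epsilon> * (1 + \<epsilon> * w) / 4 \<le> \<mu>" .
  have "\<epsilon> * (1 + \<epsilon> * w) > 0" using \<epsilon>(1) w by (intro mult_pos_pos add_pos_nonneg) auto
  then have "1 / \<mu> \<le> 1 / (\<epsilon> * (1 + \<epsilon> * w) / 4)"
    using \<mu>_ge by (intro divide_left_mono mult_pos_pos) auto
  then have t1: "1 / \<mu> \<le> 4 / (\<epsilon> * (1 + \<epsilon> * w))" by simp
  have "p / (1 - p) \<le> p / (1/2)" using p_pos p_half by (intro divide_left_mono) auto
  also have "\<dots> \<le> 4 * ln n / (\<epsilon> * n)" using p_le by simp
  finally have t2: "p / (1 - p) \<le> 4 * ln n / (\<epsilon> * n)" .
  have "1 / (p * (\<epsilon> * n)\<^sup>2) \<le> 1 / (ln n / (4 * n) * (\<epsilon> * n)\<^sup>2)"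
    using p_ge p_pos \<epsilon>(1) npos n(2)
    by (intro divide_left_mono mult_right_mono mult_pos_pos divide_pos_pos) (auto simp del: ln_gt_zero_iff)
  also have "\<dots> = 4 / (\<epsilon>\<^sup>2 * n * ln n)"
    using \<epsilon> npos n by (simp add: field_simps power2_eq_square)
  finally have t3: "1 / (p * (\<epsilon> * n)\<^sup>2) \<le> 4 / (\<epsilon>\<^sup>2 * n * ln n)" .
  have "measure_pmf.prob (random_subgraph E p) {F. min_degree V F \<ge> 2}
      \<le> 1 / \<mu> + p / (1 - p) + 1 / (p * (\<epsilon> * n)\<^sup>2)"
    using p_pos p_half Dpos \<epsilon> by (intro prob_min_degree_ge_2_le[OF G ne]) (auto simp: \<mu>_def)
  with t1 t2 t3 show ?thesis unfolding p_def p0_def by linarith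
qed

text \<open>
  Above the threshold the expected number of vertices of degree at most one is at most
  \<open>(1 + 2 n p) * S(p)\<close>; the factor \<open>ln n\<close> in \<open>1 + 2 n p\<close> cancels that in
  \<open>S(p) \<le> exp (- \<epsilon> w) / ln n\<close>. The factor two comes from \<open>1 - p \<ge> 1/2\<close>.
\<close>

lemma prob_above_threshold_ge:
  fixes w \<epsilon> :: real
  assumes G: "simple_graph V E" and n: "n = real (card V)" "ln n \<ge> 1"
    and \<epsilon>: "\<epsilon> > 0" "\<And>v. v \<in> V \<Longrightarrow> \<epsilon> * n \<le> real (degree E v)"
    and w: "0 \<le> w" "w \<le> ln n / 4" and small: "2 * ln n / (\<epsilon> * n) + w / n \<le> 1/2"
  shows "1 - (3 + 4 / \<epsilon>) * exp (- (\<epsilon> * w))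
    \<le> measure_pmf.prob (random_subgraph E (threshold_p0 V E + w / n)) {F. min_degree V F \<ge> 2}"
proof -
  define p0 where "p0 = threshold_p0 V E"
  define p where "p = p0 + w / n"
  define S where "S = (\<Sum>v\<in>V. (1 - p) ^ degree E v)"
  have npos: "n > 0" using n by (cases "card V = 0") auto
  have fin: "finite V" and ne: "V \<noteq> {}" using G npos n by (auto simp: simple_graph_def)
  have Dpos: "\<epsilon> * n > 0" using \<epsilon> npos by simp
  have deg: "degree E v > 0" if "v \<in> V" for v using Dpos \<epsilon>(2)[OF that] by linarith
  note p0 = threshold_p0_solves[OF fin n(2)[unfolded n(1)] deg, folded p0_def n(1)]
  note p0b = threshold_p0_bounds[OF G n(2)[unfolded n(1)], folded n(1) p0_def, OF Dpos \<epsilon>(2)]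
  have p_half: "p \<le> 1/2" using p0b(1) small by (simp add: p_def)
  have p_ge0: "p \<ge> 0" using p0(1) w npos by (simp add: p_def)
  have "n * p = n * p0 + w" using npos by (simp add: p_def field_simps)
  also have "n * p0 \<le> n * (2 * ln n / (\<epsilon> * n))" using p0b(1) npos by (intro mult_left_mono) auto
  also have "\<dots> = 2 / \<epsilon> * ln n" using npos by simp
  also have "2 / \<epsilon> * ln n + w \<le> (2 / \<epsilon> + 1) * ln n" using w n by (simp add: algebra_simps)
  finally have np: "n * p \<le> (2 / \<epsilon> + 1) * ln n" by simp
  have S_nonneg: "S \<ge> 0" unfolding S_def using p_half by (intro sum_nonneg) auto
  have "S \<le> exp (- (\<epsilon> * w)) * (\<Sum>v\<in>V. (1 - p0) ^ degree E v)"
    using nonedge_sum_decrease[of p0 "w / n" V "\<epsilon> * n" "degree E", folded p_def] p0 w npos \<epsilon> p_half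
    by (simp add: S_def)
  also have "(\<Sum>v\<in>V. (1 - p0) ^ degree E v) = 1 / ln n"
    using p0(3) n(2) by (simp add: nonzero_eq_divide_eq)
  finally have S_le: "S \<le> exp (- (\<epsilon> * w)) / ln n" by simp
  have "(\<Sum>v\<in>V. (1 - p) ^ degree E v + real (degree E v) * (p * (1 - p) ^ (degree E v - 1)))
     \<le> (\<Sum>v\<in>V. (1 + 2 * (n * p)) * (1 - p) ^ degree E v)"
  proof (rule sum_mono)
    fix v assume v: "v \<in> V"
    have "(1 - p) ^ (degree E v - 1) * (1/2) \<le> (1 - p) ^ (degree E v - 1) * (1 - p)"
      using p_half by (intro mult_left_mono) auto
    also have "\<dots> = (1 - p) ^ degree E v"
      using deg[OF v] by (metis power_minus_mult)
    finally have half: "(1 - p) ^ (degree E v - 1) \<le> 2 * (1 - p) ^ degree E v" by simp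
    have "real (degree E v) * (p * (1 - p) ^ (degree E v - 1)) \<le> n * (p * (2 * (1 - p) ^ degree E v))"
      using degree_le_card_vertices[OF G, of v] p_ge0 p_half half n(1)
      by (intro mult_mono mult_left_mono) auto
    then show "(1 - p) ^ degree E v + real (degree E v) * (p * (1 - p) ^ (degree E v - 1))
       \<le> (1 + 2 * (n * p)) * (1 - p) ^ degree E v"
      by (simp add: algebra_simps)
  qed
  also have "\<dots> = (1 + 2 * (n * p)) * S" by (simp add: S_def sum_distrib_left)
  also have "\<dots> \<le> (ln n + 2 * ((2 / \<epsilon> + 1) * ln n)) * (exp (- (\<epsilon> * w)) / ln n)"
  proof (intro mult_mono S_le S_nonneg)
    show "1 + 2 * (n * p) \<le> ln n + 2 * ((2 / \<epsilon> + 1) * ln n)" using np n(2) by linarith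
    show "0 \<le> ln n + 2 * ((2 / \<epsilon> + 1) * ln n)" using n(2) \<epsilon>(1) by auto
  qed
  also have "\<dots> = (3 + 4 / \<epsilon>) * exp (- (\<epsilon> * w))"
    using n(2) \<epsilon> by (simp add: field_simps)
  finally show ?thesis
    using prob_min_degree_ge_2_ge[OF G ne p_ge0] p_half unfolding p_def p0_def by linarith
qed

section \<open>The limit\<close>

theorem theorem2:
  fixes \<epsilon> :: real
    and \<omega> :: "nat \<Rightarrow> real"
    and V :: "nat \<Rightarrow> 'a set"
    and E :: "nat \<Rightarrow> 'a set set"
    and p\<^sub>0 :: "nat \<Rightarrow> real"
  defines "p\<^sub>0 \<equiv> \<lambda>n. threshold_p0 (V n) (E n)"
  assumes "\<epsilon> > 0"
    and "\<omega> \<in> o(\<lambda>n. ln (ln (real n)))"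
    and "filterlim \<omega> at_top sequentially"
    and "\<And>n. simple_graph (V n) (E n)"
    and "\<And>n. card (V n) = n"
    and "\<forall>\<^sub>F n in sequentially. real (min_degree (V n) (E n)) \<ge> \<epsilon> * real n"
  shows "((\<lambda>n. measure_pmf.prob (random_subgraph (E n) (p\<^sub>0 n - \<omega> n / real n))
              {F. min_degree (V n) F \<ge> 2}) \<longlonglongrightarrow> 0) \<and>
         ((\<lambda>n. measure_pmf.prob (random_subgraph (E n) (p\<^sub>0 n + \<omega> n / real n))
              {F. min_degree (V n) F \<ge> 2}) \<longlonglongrightarrow> 1)"
proof -
  note \<epsilon> = \<open>\<epsilon> > 0\<close>
  have "\<forall>\<^sub>F n in sequentially. \<bar>\<omega> n\<bar> \<le> 1 * \<bar>ln (ln (real n))\<bar>"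
    using landau_o.smallD[OF assms(3), of 1] by simp
  moreover have "\<forall>\<^sub>F n in sequentially. \<bar>ln (ln (real n))\<bar> \<le> ln (real n) / 4"
    by real_asymp
  ultimately have w_le: "\<forall>\<^sub>F n in sequentially. \<omega> n \<le> ln (real n) / 4"
    by eventually_elim linarith
  have w_ge: "\<forall>\<^sub>F n in sequentially. 0 \<le> \<omega> n"
    using assms(4) by (simp add: filterlim_at_top)
  have ln1: "\<forall>\<^sub>F n in sequentially. ln (real n) \<ge> 1" by real_asymp
  have small: "\<forall>\<^sub>F n in sequentially. 2 * ln (real n) / (\<epsilon> * real n) + ln (real n) / 4 / real n \<le> 1/2"
    using \<epsilon> by real_asymp
  have ev: "\<forall>\<^sub>F n in sequentially.
      simple_graph (V n) (E n) \<and> real n = real (card (V n)) \<and> ln (real n) \<ge> 1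
      \<and> (\<forall>v\<in>V n. \<epsilon> * real n \<le> real (degree (E n) v)) \<and> 0 \<le> \<omega> n \<and> \<omega> n \<le> ln (real n) / 4
      \<and> 2 * ln (real n) / (\<epsilon> * real n) + \<omega> n / real n \<le> 1/2
      \<and> 2 * ln (real n) / (\<epsilon> * real n) \<le> 1/2"
    using w_le w_ge ln1 small assms(7) eventually_gt_at_top[of 0]
  proof eventually_elim
    case (elim n)
    have "finite (V n)" using assms(5) by (simp add: simple_graph_def)
    then have "\<epsilon> * real n \<le> real (degree (E n) v)" if "v \<in> V n" for v
      using that elim min_degree_ge_iff[of "V n" "min_degree (V n) (E n)" "E n"] by fastforce
    moreover have "\<omega> n / real n \<le> ln (real n) / 4 / real n"
      using elim by (intro divide_right_mono) auto
    moreover have "0 \<le> \<omega> n / real n" using elim by simp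
    ultimately show ?case
      using elim assms(5,6) by (intro conjI ballI; (linarith | simp))
  qed
  have lim_exp: "(\<lambda>n. exp (- (\<epsilon> * \<omega> n))) \<longlonglongrightarrow> 0"
    using \<epsilon> assms(4)
    by (intro filterlim_compose[OF exp_at_bot] filterlim_compose[OF filterlim_uminus_at_bot_at_top]
        filterlim_tendsto_pos_mult_at_top[OF tendsto_const])
  have lim_inv: "(\<lambda>n. 4 / (\<epsilon> * (1 + \<epsilon> * \<omega> n))) \<longlonglongrightarrow> 0"
    using \<epsilon> assms(4)
    by (intro tendsto_divide_0[OF tendsto_const] filterlim_at_top_imp_at_infinity
        filterlim_tendsto_pos_mult_at_top[OF tendsto_const]
        filterlim_tendsto_add_at_top[OF tendsto_const])
  show ?thesis
  proof
    have "(\<lambda>n. 4 * ln (real n) / (\<epsilon> * real n) + 4 / (\<epsilon>\<^sup>2 * real n * ln (real n))) \<longlonglongrightarrow> 0"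
      using \<epsilon> by real_asymp
    from tendsto_add[OF lim_inv this]
    have lim: "(\<lambda>n. 4 / (\<epsilon> * (1 + \<epsilon> * \<omega> n)) + 4 * ln (real n) / (\<epsilon> * real n)
        + 4 / (\<epsilon>\<^sup>2 * real n * ln (real n))) \<longlonglongrightarrow> 0"
      by (simp add: add.assoc)
    show "(\<lambda>n. measure_pmf.prob (random_subgraph (E n) (p\<^sub>0 n - \<omega> n / real n))
              {F. min_degree (V n) F \<ge> 2}) \<longlonglongrightarrow> 0"
    proof (rule tendsto_sandwich[OF _ _ tendsto_const lim])
      show "\<forall>\<^sub>F n in sequentially. measure_pmf.prob (random_subgraph (E n) (p\<^sub>0 n - \<omega> n / real n))
              {F. min_degree (V n) F \<ge> 2} \<le> 4 / (\<epsilon> * (1 + \<epsilon> * \<omega> n)) + 4 * ln (real n) / (\<epsilon> * real n)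
        + 4 / (\<epsilon>\<^sup>2 * real n * ln (real n))"
        using ev unfolding p\<^sub>0_def
        by eventually_elim (rule prob_below_threshold_le; use \<epsilon> in auto)
    qed simp
  next
    have lim: "(\<lambda>n. 1 - (3 + 4 / \<epsilon>) * exp (- (\<epsilon> * \<omega> n))) \<longlonglongrightarrow> 1"
      using tendsto_diff[OF tendsto_const tendsto_mult[OF tendsto_const lim_exp]] by fastforce
    show "(\<lambda>n. measure_pmf.prob (random_subgraph (E n) (p\<^sub>0 n + \<omega> n / real n))
              {F. min_degree (V n) F \<ge> 2}) \<longlonglongrightarrow> 1"
    proof (rule tendsto_sandwich[OF _ _ lim tendsto_const])
      show "\<forall>\<^sub>F n in sequentially. 1 - (3 + 4 / \<epsilon>) * exp (- (\<epsilon> * \<omega> n))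
          \<le> measure_pmf.prob (random_subgraph (E n) (p\<^sub>0 n + \<omega> n / real n)) {F. min_degree (V n) F \<ge> 2}"
        using ev unfolding p\<^sub>0_def
        by eventually_elim (rule prob_above_threshold_ge; use \<epsilon> in auto)
    qed simp
  qed
qed

end
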